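(* Let $G$ be a weakly connected digraph with $\delta^+(G)\geq 1$. Then $Z(L(G))\leq \Delta^+(G)\,\gamma_P(L(G))$.
   Context: A digraph $G$ has a finite non-empty vertex set $V(G)$ and a set $A(G)\subseteq V(G)\times V(G)$ of arcs; loops $(u,u)$ are allowed. $N^+_G(v)=\{u:(v,u)\in A(G)\}$, $N^+_G[v]=N^+_G(v)\cup\{v\}$, $N^+_G[S]=\bigcup_{v\in S}N^+_G[v]$, $d^+_G(v)=|N^+_G(v)|$; $\delta^+(G)$ and $\Delta^+(G)$ are the minimum and maximum of $d^+_G(v)$ over $v\in V(G)$. $G$ is weakly connected if its underlying undirected graph is connected. Line digraph: $L(G)$ has vertex set $\{uv:(u,v)\in A(G)\}$, with an arc from $uv$ to $xy$ exactly when $v=x$. Zero forcing in a digraph $H$: for non-empty $S\subseteq V(H)$ put $B^0(S)=S$ and, for $i\ge 0$: if $H$ has no loops, $B^{i+1}(S)=B^i(S)\cup\{v\in V(H)\setminus B^i(S):\exists u\in B^i(S),\ N^+_H(u)\setminus B^i(S)=\{v\}\}$; if $H$ has at least one loop, $B^{i+1}(S)=B^i(S)\cup\{v\in V(H)\setminus B^i(S):\exists u\in V(H),\ N^+_H(u)\setminus B^i(S)=\{v\}\}$. $S$ is a zero forcing set if $B^m(S)=V(H)$ for some $m\ge 0$. $Z(H)$ is the minimum cardinality of a zero forcing set of $H$. Power domination in $H$: for non-empty $S\subseteq V(H)$ put $P^0(S)=S$, $P^1(S)=N^+_H[S]$, and for $i\geq 1$ obtain $P^{i+1}(S)$ from $P^i(S)$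 by the same rule by which $B^{i+1}(S)$ is obtained from $B^i(S)$ (the loopless rule if $H$ has no loops, the other rule if $H$ has at least one loop). $S$ is a power dominating set if $P^t(S)=V(H)$ for some $t\ge 0$; equivalently, $N^+_H[S]$ is a zero forcing set. $\gamma_P(H)$ is the minimum cardinality of a power dominating set of $H$. *)

theory Defs
  imports "Graph_Theory.Pair_Digraph" "Graph_Theory.Digraph_Component"
begin

text \<open>
  Digraphs are finite, non-empty, may have loops and have no parallel arcs. They are rendered by
  the record \<open>'a pair_pre_digraph\<close> together with the locale predicate \<open>pair_fin_digraph\<close>, which
  allows loops and also the null graph, so that non-emptiness is an extra condition. The
  graph-theoretic \<open>connected\<close> of the library is weak connectivity: strong connectivity of the
  symmetric closure.
\<close>

definition out_nbhd :: "'a pair_pre_digraph \<Rightarrow> 'a \<Rightarrow> 'a set" where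
  "out_nbhd H v = {u. (v, u) \<in> parcs H}"

definition closed_out_nbhd :: "'a pair_pre_digraph \<Rightarrow> 'a \<Rightarrow> 'a set" where
  "closed_out_nbhd H v = out_nbhd H v \<union> {v}"

definition closed_out_nbhd_set :: "'a pair_pre_digraph \<Rightarrow> 'a set \<Rightarrow> 'a set" where
  "closed_out_nbhd_set H S = (\<Union>v\<in>S. closed_out_nbhd H v)"

text \<open>The library's \<open>out_degree\<close> counts arcs; here it also counts out-neighbours.\<close>

lemma out_degree_eq_card_out_nbhd: "out_degree (with_proj H) v = card (out_nbhd H v)"
proof -
  have "out_arcs (with_proj H) v = Pair v ` out_nbhd H v"
    by (auto simp: out_arcs_def out_nbhd_def)
  then show ?thesis
    by (simp add: out_degree_def card_image inj_on_def)
qed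

definition min_out_degree :: "'a pair_pre_digraph \<Rightarrow> nat" where
  "min_out_degree H = Min (out_degree (with_proj H) ` pverts H)"

definition max_out_degree :: "'a pair_pre_digraph \<Rightarrow> nat" where
  "max_out_degree H = Max (out_degree (with_proj H) ` pverts H)"

definition line_digraph :: "'a pair_pre_digraph \<Rightarrow> ('a \<times> 'a) pair_pre_digraph" where
  "line_digraph G = \<lparr> pverts = parcs G,
     parcs = {((u, v), (x, y)) | u v x y. (u, v) \<in> parcs G \<and> (x, y) \<in> parcs G \<and> v = x} \<rparr>"

lemma pair_fin_digraph_line_digraph:
  assumes "pair_fin_digraph G"
  shows "pair_fin_digraph (line_digraph G)"
proof -
  interpret pair_fin_digraph G by (rule assms)
  have "parcs (line_digraph G) \<subseteq> parcs G \<times> parcs G"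
    by (auto simp: line_digraph_def)
  then have "finite (parcs (line_digraph G))"
    using pair_finite_arcs finite_subset by blast
  then show ?thesis
    by unfold_locales (use pair_finite_arcs in \<open>auto simp: line_digraph_def\<close>)
qed

definition has_loop :: "'a pair_pre_digraph \<Rightarrow> bool" where
  "has_loop H \<longleftrightarrow> (\<exists>v. (v, v) \<in> parcs H)"

text \<open>
  With a loop anywhere in the digraph, every vertex may force; without loops, only the vertices
  of \<open>B\<close> may.
\<close>

definition force_step :: "'a pair_pre_digraph \<Rightarrow> 'a set \<Rightarrow> 'a set" where
  "force_step H B =
     (if has_loop H
      then B \<union> {v \<in> pverts H - B. \<exists>u\<in>pverts H. out_nbhd H u - B = {v}}
      else B \<union> {v \<in> pverts H - B. \<exists>u\<in>B. out_nbhd H u - B = {v}})"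

primrec zf_seq :: "'a pair_pre_digraph \<Rightarrow> 'a set \<Rightarrow> nat \<Rightarrow> 'a set" where
  "zf_seq H S 0 = S"
| "zf_seq H S (Suc i) = force_step H (zf_seq H S i)"

definition zero_forcing_set :: "'a pair_pre_digraph \<Rightarrow> 'a set \<Rightarrow> bool" where
  "zero_forcing_set H S \<longleftrightarrow>
     S \<noteq> {} \<and> S \<subseteq> pverts H \<and> (\<exists>m. zf_seq H S m = pverts H)"

definition zero_forcing_number :: "'a pair_pre_digraph \<Rightarrow> nat" where
  "zero_forcing_number H = Min (card ` {S. zero_forcing_set H S})"

fun pd_seq :: "'a pair_pre_digraph \<Rightarrow> 'a set \<Rightarrow> nat \<Rightarrow> 'a set" where
  "pd_seq H S 0 = S"
| "pd_seq H S (Suc 0) = closed_out_nbhd_set H S"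
| "pd_seq H S (Suc (Suc i)) = force_step H (pd_seq H S (Suc i))"

definition power_dominating_set :: "'a pair_pre_digraph \<Rightarrow> 'a set \<Rightarrow> bool" where
  "power_dominating_set H S \<longleftrightarrow>
     S \<noteq> {} \<and> S \<subseteq> pverts H \<and> (\<exists>t. pd_seq H S t = pverts H)"

definition power_domination_number :: "'a pair_pre_digraph \<Rightarrow> nat" where
  "power_domination_number H = Min (card ` {S. power_dominating_set H S})"

text \<open>Both minima range over finite non-empty sets, so they are genuine minima.\<close>

lemma zero_forcing_number_well_defined:
  assumes "finite (pverts H)" "pverts H \<noteq> {}"
  shows "finite (card ` {S. zero_forcing_set H S})" "card ` {S. zero_forcing_set H S} \<noteq> {}"
proof -
  have "{S. zero_forcing_set H S} \<subseteq> Pow (pverts H)"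
    by (auto simp: zero_forcing_set_def)
  with assms(1) show "finite (card ` {S. zero_forcing_set H S})"
    by (meson finite_Pow_iff finite_imageI finite_subset)
  have "zf_seq H (pverts H) 0 = pverts H" by simp
  with assms(2) have "zero_forcing_set H (pverts H)"
    unfolding zero_forcing_set_def by blast
  then show "card ` {S. zero_forcing_set H S} \<noteq> {}" by blast
qed

lemma power_domination_number_well_defined:
  assumes "finite (pverts H)" "pverts H \<noteq> {}"
  shows "finite (card ` {S. power_dominating_set H S})"
    "card ` {S. power_dominating_set H S} \<noteq> {}"
proof -
  have "{S. power_dominating_set H S} \<subseteq> Pow (pverts H)"
    by (auto simp: power_dominating_set_def)
  with assms(1) show "finite (card ` {S. power_dominating_set H S})"
    by (meson finite_Pow_iff finite_imageI finite_subset)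
  have "pd_seq H (pverts H) 0 = pverts H" by simp
  with assms(2) have "power_dominating_set H (pverts H)"
    unfolding power_dominating_set_def by blast
  then show "card ` {S. power_dominating_set H S} \<noteq> {}" by blast
qed

end

theory Submission
  imports Defs
begin

text \<open>
  The bound is a property of all finite digraphs \<open>H\<close> without sinks: if every out-degree lies
  between \<open>1\<close> and \<open>D\<close>, then the zero forcing number is at most \<open>D\<close> times the power domination
  number. The closed out-neighbourhood of a power dominating set \<open>S\<close> is a zero forcing set, but it
  may have \<open>(D + 1) * card S\<close> elements. To save one element per vertex \<open>u\<close> of \<open>S\<close>, leave out a
  single out-neighbour of \<open>u\<close>: as \<open>u\<close> itself is kept, it forces the omitted out-neighbour in the
  first step, unless another vertex of \<open>S\<close> already supplies it. So one step recovers the closed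
  out-neighbourhood (\<open>closed_out_nbhd_set_subset_force_step\<close>), and from there monotonicity of
  forcing (\<open>force_step_mono\<close>) carries the power domination process over to a zero forcing process.

  The line digraph of \<open>G\<close> is such an \<open>H\<close>: the out-neighbours of an arc \<open>(u, v)\<close> are the arcs
  leaving \<open>v\<close>, so its out-degrees are out-degrees of \<open>G\<close>.
\<close>

text \<open>
  A force that was available from \<open>B\<close> either is still available from a larger \<open>C\<close> or has become
  superfluous, because its target already lies in \<open>C\<close>.
\<close>

lemma force_step_mono:
  assumes "B \<subseteq> C"
  shows "force_step H B \<subseteq> force_step H C"
proof
  fix x
  assume x: "x \<in> force_step H B"
  have kept: "out_nbhd H u - C = {x}" if "out_nbhd H u - B = {x}" "x \<notin> C" for u
    using that assms by blast
  show "x \<in> force_step H C"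
  proof (cases "x \<in> C")
    case True
    then show ?thesis by (simp add: force_step_def)
  next
    case False
    then have "x \<notin> B" using assms by blast
    show ?thesis
    proof (cases "has_loop H")
      case True
      with x \<open>x \<notin> B\<close> obtain u where
        "x \<in> pverts H" "u \<in> pverts H" "out_nbhd H u - B = {x}"
        by (auto simp: force_step_def)
      with kept False True show ?thesis by (auto simp: force_step_def)
    next
      case no_loop: False
      with x \<open>x \<notin> B\<close> obtain u where
        "x \<in> pverts H" "u \<in> B" "out_nbhd H u - B = {x}"
        by (auto simp: force_step_def)
      with kept False no_loop assms show ?thesis by (auto simp: force_step_def)
    qed
  qed
qed

lemma force_step_subset_pverts:
  assumes "B \<subseteq> pverts H"
  shows "force_step H B \<subseteq> pverts H"
  using assms by (auto simp: force_step_def)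

lemma zf_seq_subset_pverts:
  assumes "B \<subseteq> pverts H"
  shows "zf_seq H B m \<subseteq> pverts H"
  by (induction m) (simp_all add: assms force_step_subset_pverts)

lemma pd_seq_Suc_subset_zf_seq_Suc:
  assumes "closed_out_nbhd_set H S \<subseteq> force_step H B"
  shows "pd_seq H S (Suc i) \<subseteq> zf_seq H B (Suc i)"
proof (induction i)
  case 0
  show ?case using assms by simp
next
  case (Suc i)
  then show ?case
    unfolding pd_seq.simps(3) zf_seq.simps(2)[of _ _ "Suc i"] by (rule force_step_mono)
qed

definition trimmed_closed_out_nbhd_set ::
    "'a pair_pre_digraph \<Rightarrow> ('a \<Rightarrow> 'a) \<Rightarrow> 'a set \<Rightarrow> 'a set" where
  "trimmed_closed_out_nbhd_set H w S = (\<Union>u\<in>S. insert u (out_nbhd H u - {w u}))"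

text \<open>
  Since \<open>u\<close> stays in the trimmed set, \<open>w u\<close> is the only out-neighbour of \<open>u\<close> that can be missing,
  so \<open>u\<close> may force it under either colour change rule.
\<close>

lemma closed_out_nbhd_set_subset_force_step:
  assumes "S \<subseteq> pverts H" and closed: "\<And>u. u \<in> S \<Longrightarrow> out_nbhd H u \<subseteq> pverts H"
  shows "closed_out_nbhd_set H S \<subseteq> force_step H (trimmed_closed_out_nbhd_set H w S)"
proof
  fix x
  let ?B = "trimmed_closed_out_nbhd_set H w S"
  assume "x \<in> closed_out_nbhd_set H S"
  then obtain u where u: "u \<in> S" and x: "x = u \<or> x \<in> out_nbhd H u"
    by (auto simp: closed_out_nbhd_set_def closed_out_nbhd_def)
  have uB: "u \<in> ?B" and kept: "out_nbhd H u - {w u} \<subseteq> ?B"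
    using u by (auto simp: trimmed_closed_out_nbhd_set_def)
  show "x \<in> force_step H ?B"
  proof (cases "x \<in> ?B")
    case True
    then show ?thesis by (auto simp: force_step_def)
  next
    case False
    with x uB kept have "out_nbhd H u - ?B = {x}" by blast
    moreover have "x \<in> pverts H" using False x uB closed[OF u] by blast
    moreover have "u \<in> pverts H" using u assms(1) by blast
    ultimately show ?thesis
      using False uB unfolding force_step_def by auto
  qed
qed

text \<open>
  Requiring \<open>w u\<close> to be an out-neighbour of \<open>u\<close> is what makes room for \<open>u\<close>: it is why sinks have
  to be excluded.
\<close>

lemma card_trimmed_closed_out_nbhd_set_le:
  assumes "finite S"
    and "\<And>u. u \<in> S \<Longrightarrow> finite (out_nbhd H u)"
    and "\<And>u. u \<in> S \<Longrightarrow> w u \<in> out_nbhd H u"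
    and "\<And>u. u \<in> S \<Longrightarrow> card (out_nbhd H u) \<le> D"
  shows "card (trimmed_closed_out_nbhd_set H w S) \<le> D * card S"
proof -
  have "card (insert u (out_nbhd H u - {w u})) \<le> D" if "u \<in> S" for u
  proof -
    have "card (insert u (out_nbhd H u - {w u})) \<le> Suc (card (out_nbhd H u - {w u}))"
      by (rule card_insert_le_m1) simp_all
    also have "\<dots> = card (out_nbhd H u)"
      using assms(2,3) that by (intro card_Suc_Diff1) auto
    also have "\<dots> \<le> D" using assms(4) that .
    finally show ?thesis .
  qed
  then have bound: "(\<Sum>u\<in>S. card (insert u (out_nbhd H u - {w u}))) \<le> of_nat (card S) * D"
    by (rule sum_bounded_above)
  have "card (trimmed_closed_out_nbhd_set H w S)
          \<le> (\<Sum>u\<in>S. card (insert u (out_nbhd H u - {w u})))"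
    unfolding trimmed_closed_out_nbhd_set_def using assms(1) by (rule card_UN_le)
  also note bound
  finally show ?thesis unfolding of_nat_id mult.commute[of _ D] .
qed

lemma zero_forcing_set_trimmed_closed_out_nbhd_set:
  assumes "power_dominating_set H S"
    and closed: "\<And>u. u \<in> S \<Longrightarrow> out_nbhd H u \<subseteq> pverts H"
  shows "zero_forcing_set H (trimmed_closed_out_nbhd_set H w S)"
proof -
  let ?B = "trimmed_closed_out_nbhd_set H w S"
  obtain t where S: "S \<noteq> {}" "S \<subseteq> pverts H" and t: "pd_seq H S t = pverts H"
    using assms(1) by (auto simp: power_dominating_set_def)
  have SB: "S \<subseteq> ?B" by (auto simp: trimmed_closed_out_nbhd_set_def)
  have B: "?B \<subseteq> pverts H"
    using S(2) closed by (auto simp: trimmed_closed_out_nbhd_set_def)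
  have "pd_seq H S t \<subseteq> zf_seq H ?B t"
  proof (cases t)
    case 0
    with SB show ?thesis by simp
  next
    case (Suc i)
    have "closed_out_nbhd_set H S \<subseteq> force_step H ?B"
      using S(2) closed by (rule closed_out_nbhd_set_subset_force_step)
    then show ?thesis
      unfolding Suc by (rule pd_seq_Suc_subset_zf_seq_Suc)
  qed
  then have "zf_seq H ?B t = pverts H"
    using t zf_seq_subset_pverts[OF B] by blast
  with S(1) SB B show ?thesis
    unfolding zero_forcing_set_def by blast
qed

theorem zero_forcing_number_le_mult_power_domination_number:
  assumes "pair_fin_digraph H" and "pverts H \<noteq> {}"
    and no_sink: "\<And>u. u \<in> pverts H \<Longrightarrow> out_nbhd H u \<noteq> {}"
    and bound: "\<And>u. u \<in> pverts H \<Longrightarrow> card (out_nbhd H u) \<le> D"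
  shows "zero_forcing_number H \<le> D * power_domination_number H"
proof -
  interpret pair_fin_digraph H by (rule assms(1))
  have closed: "out_nbhd H u \<subseteq> pverts H" for u
    by (auto simp: out_nbhd_def in_arcsD2)
  obtain S where S: "power_dominating_set H S" "power_domination_number H = card S"
    using Min_in[OF power_domination_number_well_defined] assms(2) pair_finite_verts
    unfolding power_domination_number_def by blast
  then have SH: "S \<subseteq> pverts H" by (simp add: power_dominating_set_def)
  define w where "w u = (SOME x. x \<in> out_nbhd H u)" for u
  let ?B = "trimmed_closed_out_nbhd_set H w S"
  have "zero_forcing_number H \<le> card ?B"
    unfolding zero_forcing_number_def
    using zero_forcing_set_trimmed_closed_out_nbhd_set[OF S(1) closed] assms(2)
    by (intro Min_le zero_forcing_number_well_defined(1)) auto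
  also have "\<dots> \<le> D * card S"
  proof (rule card_trimmed_closed_out_nbhd_set_le)
    show "finite S" using SH pair_finite_verts by (rule finite_subset)
    show "finite (out_nbhd H u)" for u
      using closed pair_finite_verts by (rule finite_subset)
    show "w u \<in> out_nbhd H u" if "u \<in> S" for u
      using no_sink that SH unfolding w_def by (metis some_in_eq subsetD)
    show "card (out_nbhd H u) \<le> D" if "u \<in> S" for u
      using bound that SH by blast
  qed
  finally show ?thesis using S(2) by simp
qed

lemma out_nbhd_line_digraph:
  assumes "(u, v) \<in> parcs G"
  shows "out_nbhd (line_digraph G) (u, v) = Pair v ` out_nbhd G v"
  using assms by (auto simp: out_nbhd_def line_digraph_def)

theorem theorem4p1:
  fixes G :: "'a pair_pre_digraph"
  assumes "pair_fin_digraph G"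
    and "pverts G \<noteq> {}"
    and "connected (with_proj G)"
    and "min_out_degree G \<ge> 1"
  shows "zero_forcing_number (line_digraph G)
           \<le> max_out_degree G * power_domination_number (line_digraph G)"
proof -
  interpret pair_fin_digraph G by (rule assms(1))
  have degree: "1 \<le> card (out_nbhd G v)" "card (out_nbhd G v) \<le> max_out_degree G"
    if "v \<in> pverts G" for v
  proof -
    have "min_out_degree G \<le> card (out_nbhd G v)"
      unfolding min_out_degree_def out_degree_eq_card_out_nbhd
      using that pair_finite_verts by (intro Min_le) auto
    with assms(4) show "1 \<le> card (out_nbhd G v)" by simp
    show "card (out_nbhd G v) \<le> max_out_degree G"
      unfolding max_out_degree_def out_degree_eq_card_out_nbhd
      using that pair_finite_verts by (intro Max_ge) auto
  qed
  show ?thesis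
  proof (rule zero_forcing_number_le_mult_power_domination_number)
    show "pair_fin_digraph (line_digraph G)"
      using assms(1) by (rule pair_fin_digraph_line_digraph)
    obtain v where "v \<in> pverts G" using assms(2) by blast
    with degree(1)[of v] have "out_nbhd G v \<noteq> {}" by auto
    then show "pverts (line_digraph G) \<noteq> {}"
      by (auto simp: out_nbhd_def line_digraph_def)
  next
    fix a assume "a \<in> pverts (line_digraph G)"
    then obtain u v where a: "a = (u, v)" "(u, v) \<in> parcs G"
      by (cases a) (auto simp: line_digraph_def)
    then have v: "v \<in> pverts G" by (simp add: in_arcsD2)
    have nbhd: "out_nbhd (line_digraph G) a = Pair v ` out_nbhd G v"
      using a by (simp add: out_nbhd_line_digraph)
    show "out_nbhd (line_digraph G) a \<noteq> {}"
      using degree(1)[OF v] nbhd by auto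
    show "card (out_nbhd (line_digraph G) a) \<le> max_out_degree G"
      using degree(2)[OF v] nbhd by (simp add: card_image inj_on_def)
  qed
qed

end
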